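(* Let $(M,\mathcal E,\mathcal D,\psi)$ be a generalized metric gradient system satisfying the standing assumptions listed in the context, with the associated number $\sigma_*>0$. Assume additionally that 1. $(M,\mathcal D)$ is a geodesic space, 2. $\mathcal E$ is continuous on $M$, 3. $|\partial\mathcal E|$ is upper semicontinuous on $M$. Let $u^\circ\in\mathrm{dom}(\mathcal E)$. Then for any measurable selection $(0,\sigma_* )\ni\sigma\mapsto\tilde u_\sigma\in J_\sigma(u^\circ)$ and all $\sigma\in(0,\sigma_* )$, $$\mathcal E(\tilde u_\sigma)+\sigma\,\psi\Big(\frac1\sigma\mathcal D(u^\circ,\tilde u_\sigma)\Big)+\int_0^\sigma\psi^*\big(|\partial\mathcal E|(\tilde u_\rho)\big)\,d\rho=\mathcal E(u^\circ).$$
   Context: A generalized metric gradient system is a quadruple $(M,\mathcal E,\mathcal D,\psi)$ where $(M,\mathcal D)$ is a complete metric space; $\mathcal E:M\to(-\infty,\infty]$ is proper (i.e. $\mathrm{dom}(\mathcal E)=\{u:\mathcal E(u)<\infty\}\neq\emptyset$) and lower semicontinuous; $\psi:\mathbb R\to[0,\infty)$ is proper and convex, with $\psi(0)=0$ and $\lim_{r\to\infty}\psi(r)/r=\infty$. The convex conjugate is $\psi^*(s)=\sup_{r\in[0,\infty)}(sr-\psi(r))$ for $s\ge0$. For $u^\circ\in M$ and $\sigma>0$ set $\Phi_\sigma(u^\circ;u)=\sigma\psi\big(\frac1\sigma\mathcal D(u^\circ,u)\big)+\mathcal E(u)$ for $u\in M$, and let $J_\sigma(u^\circ)=\mathrm{Argmin}\{\Phi_\sigma(u^\circ;u):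 u\in M\}$ be the set of global minimizers. Standing assumptions: (i) $\psi\in C^1(\mathbb R)$ is strictly convex; (ii) $\mathcal E$ is bounded from below by some $E_0$, namely $\inf_{u\in M}\mathcal E(u)>E_0>0$; (iii) there exists $\sigma_*>0$ such that $J_\sigma(u^\circ)\neq\emptyset$ for all $\sigma\in(0,\sigma_* )$ and all $u^\circ\in\mathrm{dom}(\mathcal E)$. The metric slope of a functional $\mathcal F$ at $u\in\mathrm{dom}(\mathcal F)$ is $|\partial\mathcal F|(u)=\limsup_{v\to u}\frac{(\mathcal F(u)-\mathcal F(v))^+}{\mathcal D(u,v)}\in[0,\infty]$ (equal to $0$ at isolated points). $(M,\mathcal D)$ is a geodesic space if any two points $u_0,u_1\in M$ are joined by a constant-speed geodesic, i.e. a curve $\gamma:[0,1]\to M$ with $\gamma_0=u_0$, $\gamma_1=u_1$ and $\mathcal D(\gamma_s,\gamma_t)=|t-s|\,\mathcal D(u_0,u_1)$ for all $s,t\in[0,1]$. *)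

theory Defs
  imports "HOL-Analysis.Analysis"
begin

definition edom :: "('a \<Rightarrow> ereal) \<Rightarrow> 'a set" where
  "edom F = {u. F u < \<infinity>}"

text \<open>\<^term>\<open>at u\<close> is the punctured neighbourhood filter; at isolated points \<^const>\<open>Liminf\<close>
  and \<^const>\<open>Limsup\<close> are \<open>\<infinity>\<close> and \<open>-\<infinity>\<close>, respectively, so both conditions below hold there trivially.\<close>

definition lower_semicontinuous :: "('a::topological_space \<Rightarrow> ereal) \<Rightarrow> bool" where
  "lower_semicontinuous F \<longleftrightarrow> (\<forall>u. F u \<le> Liminf (at u) F)"

definition upper_semicontinuous :: "('a::topological_space \<Rightarrow> ereal) \<Rightarrow> bool" where
  "upper_semicontinuous F \<longleftrightarrow> (\<forall>u. Limsup (at u) F \<le> F u)"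

definition strictly_convex :: "(real \<Rightarrow> real) \<Rightarrow> bool" where
  "strictly_convex f \<longleftrightarrow>
    (\<forall>x y t. x \<noteq> y \<and> 0 < t \<and> t < 1 \<longrightarrow> f ((1 - t) * x + t * y) < (1 - t) * f x + t * f y)"

text \<open>The metric space \<open>M\<close> is the carrier type, with metric \<^term>\<open>dist\<close>. The function \<open>\<psi>\<close> is
  real-valued and hence automatically proper.\<close>

locale generalized_metric_gradient_system =
  fixes \<E> :: "'a::complete_space \<Rightarrow> ereal" and \<psi> :: "real \<Rightarrow> real"
  assumes energy_not_minfty: "\<And>u. \<E> u > -\<infinity>"
    and energy_proper: "edom \<E> \<noteq> {}"
    and energy_lsc: "lower_semicontinuous \<E>"
    and psi_nonneg: "\<And>r. \<psi> r \<ge> 0"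
    and psi_convex: "convex_on UNIV \<psi>"
    and psi_zero: "\<psi> 0 = 0"
    and psi_superlinear: "filterlim (\<lambda>r. \<psi> r / r) at_top at_top"

text \<open>The argument is extended because metric slopes may be infinite; for \<open>s = \<infinity>\<close> the supremum is
  \<open>\<infinity>\<close>. If \<open>\<psi> 0 = 0\<close>, the term \<open>r = 0\<close> makes the value nonnegative.\<close>

definition convex_conjugate :: "(real \<Rightarrow> real) \<Rightarrow> ereal \<Rightarrow> ereal" where
  "convex_conjugate \<psi> s = (SUP r\<in>{0..}. s * ereal r - ereal (\<psi> r))"

definition \<Phi> :: "('a::metric_space \<Rightarrow> ereal) \<Rightarrow> (real \<Rightarrow> real) \<Rightarrow> real \<Rightarrow> 'a \<Rightarrow> 'a \<Rightarrow> ereal" where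
  "\<Phi> \<E> \<psi> \<sigma> u0 u = ereal (\<sigma> * \<psi> (1 / \<sigma> * dist u0 u)) + \<E> u"

definition J :: "('a::metric_space \<Rightarrow> ereal) \<Rightarrow> (real \<Rightarrow> real) \<Rightarrow> real \<Rightarrow> 'a \<Rightarrow> 'a set" where
  "J \<E> \<psi> \<sigma> u0 = {u. \<forall>v. \<Phi> \<E> \<psi> \<sigma> u0 u \<le> \<Phi> \<E> \<psi> \<sigma> u0 v}"

text \<open>Outside the domain the slope is \<open>\<infinity>\<close> by convention. When \<open>F\<close> is continuous, its domain is open,
  so upper semicontinuity of the slope on the whole space then only constrains points of the domain.\<close>

definition metric_slope :: "('a::metric_space \<Rightarrow> ereal) \<Rightarrow> 'a \<Rightarrow> ereal" where
  "metric_slope F u =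
    (if u \<notin> edom F then \<infinity>
     else if at u = bot then 0
     else Limsup (at u) (\<lambda>v. max 0 (F u - F v) / ereal (dist u v)))"

definition geodesic_space :: "'a::metric_space set \<Rightarrow> bool" where
  "geodesic_space S \<longleftrightarrow>
    (\<forall>u0\<in>S. \<forall>u1\<in>S. \<exists>\<gamma> :: real \<Rightarrow> 'a. \<gamma> ` {0..1} \<subseteq> S \<and> \<gamma> 0 = u0 \<and> \<gamma> 1 = u1 \<and>
      (\<forall>s\<in>{0..1}. \<forall>t\<in>{0..1}. dist (\<gamma> s) (\<gamma> t) = \<bar>t - s\<bar> * dist u0 u1))"

end

theory Submission
  imports Defs
begin

text \<open>Let \<open>e(\<sigma>)\<close> be the minimal value of \<open>\<Phi>\<^sub>\<sigma>(u\<^sub>0; \<cdot>)\<close> and \<open>d(\<sigma>)\<close> the distance from \<open>u\<^sub>0\<close> to the selected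
  minimizer. Comparing minimizers for different parameters shows that \<open>d\<close> is monotone and that \<open>e\<close> is
  locally Lipschitz with \<open>e'(\<sigma>) = - \<psi>\<^sup>*(\<psi>'(d(\<sigma>)/\<sigma>))\<close> wherever \<open>d\<close> is continuous, that is, outside a
  countable set; since \<open>e(\<sigma>)\<close> tends to the energy of \<open>u\<^sub>0\<close> as \<open>\<sigma>\<close> tends to \<open>0\<close>, integration gives the energy
  identity with \<open>\<psi>'(d(\<sigma>)/\<sigma>)\<close> in place of the slope. Minimality bounds the slope at the minimizer by
  \<open>\<psi>'(d(\<sigma>)/\<sigma>)\<close>; the opposite inequality comes from the decrease of the energy along a geodesic towards
  the minimizer together with the upper semicontinuity of the slope.\<close>

section \<open>Fundamental theorem of calculus with a negligible exceptional set\<close>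

text \<open>Dominated convergence for the difference quotients of \<open>F\<close>. The library's fundamental theorem of calculus
  admits only finitely many exceptional points.\<close>

lemma Lipschitz_fundamental_theorem_of_calculus:
  fixes F f :: "real \<Rightarrow> real"
  assumes "a \<le> b" and lip: "L-lipschitz_on {a..b} F" and N: "negligible N"
    and deriv: "\<And>x. x \<in> {a<..<b} - N \<Longrightarrow> (F has_real_derivative f x) (at x)"
  shows "(f has_integral (F b - F a)) {a..b}"
proof -
  \<comment> \<open>Constant continuation of \<open>F\<close> outside \<open>[a, b]\<close>: it
    stays \<open>L\<close>-Lipschitz, and forward difference quotients make sense up to
    \<open>b\<close>.\<close>
  define G where "G x = F (max a (min b x))" for x
  define h where "h n = 1 / real (Suc n)" for n
  have h: "h n > 0" for n by (simp add: h_def)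
  have h0: "h \<longlonglongrightarrow> 0" unfolding h_def by (rule LIMSEQ_Suc) (rule lim_1_over_n)
  define q where "q n x = (G (x + h n) - G x) / h n" for n x
  have L: "L \<ge> 0" using lip by (rule lipschitz_on_nonneg)
  have GL: "\<bar>G x - G y\<bar> \<le> L * \<bar>x - y\<bar>" for x y
  proof -
    have "\<bar>G x - G y\<bar> \<le> L * \<bar>max a (min b x) - max a (min b y)\<bar>"
      using lipschitz_onD[OF lip, of "max a (min b x)" "max a (min b y)"] \<open>a \<le> b\<close>
      by (auto simp: G_def dist_real_def)
    also have "\<dots> \<le> L * \<bar>x - y\<bar>" using L by (intro mult_left_mono) auto
    finally show ?thesis .
  qed
  have Gcont: "continuous_on S G" for S
    by (rule lipschitz_on_continuous_on[of L]) (auto simp: lipschitz_on_def dist_real_def L GL)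
  have Gint: "G integrable_on {x..y}" for x y
    by (rule integrable_continuous_real[OF Gcont])
  have Gsint: "(\<lambda>x. G (x + c)) integrable_on {x..y}" for x y c
    by (intro integrable_continuous_real continuous_on_compose2[OF Gcont] continuous_intros) auto
  let ?N = "insert a (insert b N)"
  have negl: "negligible ?N" using N by simp
  \<comment> \<open>Shifting the integral cancels everything except two end strips of width
    \<open>h n\<close>; on the right one \<open>G\<close> equals \<open>F b\<close>.\<close>
  have q_int: "integral {a..b} (q n) = F b - integral {a..a + h n} G / h n" for n
  proof -
    have "integral {a..b} (\<lambda>x. G (x + h n)) = integral {a + h n..b + h n} G"
      using integral_shift_Icc_real[of a b G "h n"] by (simp add: o_def add.commute)
    moreover have "integral {a..a + h n} G + integral {a + h n..b + h n} G = integral {a..b + h n} G"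
      "integral {a..b} G + integral {b..b + h n} G = integral {a..b + h n} G"
      using h[of n] \<open>a \<le> b\<close> by (intro Henstock_Kurzweil_Integration.integral_combine Gint; simp)+
    moreover have "integral {b..b + h n} G = integral {b..b + h n} (\<lambda>_. F b)"
      using \<open>a \<le> b\<close> by (intro integral_cong) (auto simp: G_def)
    then have "integral {b..b + h n} G = h n * F b"
      using h[of n] by simp
    ultimately have "integral {a..b} (\<lambda>x. G (x + h n)) - integral {a..b} G = h n * F b - integral {a..a + h n} G"
      by simp
    then show ?thesis
      unfolding q_def using h[of n]
      by (simp add: integral_divide Henstock_Kurzweil_Integration.integral_diff Gint Gsint field_simps)
  qed
  have avg: "\<bar>integral {a..a + h n} G / h n - F a\<bar> \<le> L * h n" for n
  proof -
    have "integral {a..a + h n} G - h n * F a = integral {a..a + h n} (\<lambda>x. G x - F a)"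
      using h[of n] Henstock_Kurzweil_Integration.integral_diff[OF Gint integrable_const_ivl, of a "a + h n" "F a"]
      by simp
    also have "norm \<dots> \<le> (L * h n) * (a + h n - a)"
    proof (rule integral_bound)
      show "norm (G x - F a) \<le> L * h n" if "x \<in> {a..a + h n}" for x
      proof -
        have "\<bar>G x - G a\<bar> \<le> L * \<bar>x - a\<bar>" by (rule GL)
        also have "\<dots> \<le> L * h n" using that L by (intro mult_left_mono) auto
        finally show ?thesis using \<open>a \<le> b\<close> by (simp add: G_def)
      qed
    qed (use h[of n] in \<open>auto intro!: continuous_intros Gcont\<close>)
    finally have "\<bar>integral {a..a + h n} G - h n * F a\<bar> / h n \<le> L * h n"
      using h[of n] by (simp add: field_simps)
    moreover have "integral {a..a + h n} G / h n - F a = (integral {a..a + h n} G - h n * F a) / h n"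
      using h[of n] unfolding diff_divide_distrib by simp
    ultimately show ?thesis
      by (simp only: abs_divide abs_of_pos[OF h])
  qed
  have "(\<lambda>n. integral {a..a + h n} G / h n - F a) \<longlonglongrightarrow> 0"
    by (rule Lim_null_comparison[OF _ tendsto_mult_right_zero[OF h0, of L]])
      (simp only: real_norm_def avg eventually_True)
  then have lim1: "(\<lambda>n. integral {a..b} (q n)) \<longlonglongrightarrow> F b - F a"
    unfolding q_int by (intro tendsto_intros) (simp add: LIM_zero_iff)
  \<comment> \<open>Setting quotients and limit to 0 on the null set gives convergence at every
    point. The endpoints belong to \<open>?N\<close> because \<open>deriv\<close> covers only the
    open interval.\<close>
  define p where "p n x = (if x \<in> ?N then 0 else q n x)" for n x
  define f' where "f' x = (if x \<in> ?N then 0 else f x)" for x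
  have qi: "q n integrable_on {a..b}" for n
    unfolding q_def using h[of n]
    by (intro integrable_continuous_real continuous_intros continuous_on_compose2[OF Gcont] Gcont) auto
  have pi: "p n integrable_on {a..b}" for n
    by (rule integrable_spike[OF qi negl]) (simp add: p_def)
  have pq: "integral {a..b} (p n) = integral {a..b} (q n)" for n
    by (rule integral_spike[OF negl]) (simp add: p_def)
  have bd: "norm (p n x) \<le> L" for n x
    using GL[of "x + h n" x] h[of n] L by (auto simp: p_def q_def field_simps)
  have lim: "(\<lambda>n. p n x) \<longlonglongrightarrow> f' x" if x: "x \<in> {a..b}" for x
  proof (cases "x \<in> ?N")
    case False
    then have xab: "x \<in> {a<..<b} - N" using x by auto
    have "filterlim h (at 0) sequentially"
      using h0 h by (auto simp: filterlim_at intro!: always_eventually) (metis less_irrefl)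
    then have "(\<lambda>n. (F (x + h n) - F x) / h n) \<longlonglongrightarrow> f x"
      using deriv[OF xab] unfolding DERIV_def by (rule filterlim_compose[rotated])
    moreover have "eventually (\<lambda>n. h n < b - x) sequentially"
      using order_tendstoD(2)[OF h0, of "b - x"] xab by simp
    then have "eventually (\<lambda>n. (F (x + h n) - F x) / h n = p n x) sequentially"
    proof eventually_elim
      case (elim n)
      then have "min b (x + h n) = x + h n" "max a (x + h n) = x + h n" "min b x = x" "max a x = x"
        using xab h[of n] by auto
      then show ?case using False by (simp add: p_def q_def G_def)
    qed
    ultimately show ?thesis
      using False by (auto simp: f'_def intro: Lim_transform_eventually)
  qed (simp add: p_def f'_def)
  have *: "f' integrable_on {a..b}" "(\<lambda>n. integral {a..b} (p n)) \<longlonglongrightarrow> integral {a..b} f'"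
    using dominated_convergence[where f = p and g = f' and h = "\<lambda>_. L" and S = "{a..b}"] pi bd lim by auto
  then have "integral {a..b} f' = F b - F a"
    using lim1 LIMSEQ_unique unfolding pq by blast
  then have "(f' has_integral F b - F a) {a..b}"
    using *(1) by (metis integrable_integral)
  then show ?thesis
    by (rule has_integral_spike[OF negl, rotated]) (simp add: f'_def)
qed

section \<open>Strictly convex potentials and their conjugates\<close>

text \<open>Convexity gives the weak tangent inequality at the midpoint of \<open>x\<close> and
  \<open>y\<close>; strict convexity at that midpoint makes it strict at \<open>y\<close>.\<close>

lemma strictly_convex_above_tangent:
  fixes f :: "real \<Rightarrow> real"
  assumes f: "strictly_convex f" and deriv: "(f has_real_derivative D) (at x)" and "y \<noteq> x"
  shows "f x + D * (y - x) < f y"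
proof -
  have "convex_on UNIV f"
  proof (rule convex_onI)
    show "f ((1 - t) *\<^sub>R x + t *\<^sub>R y) \<le> (1 - t) * f x + t * f y" if "0 < t" "t < 1" for t x y
      using f[unfolded strictly_convex_def, rule_format, of x y t] that
      by (cases "x = y") (simp_all add: algebra_simps)
  qed simp
  then have "f z - f x \<ge> D * (z - x)" for z
    by (rule convex_on_imp_above_tangent) (use deriv in auto)
  from this[of "(x + y) / 2"] have "D * (y - x) / 2 \<le> f ((x + y) / 2) - f x"
    by (simp add: field_simps)
  moreover have "f ((x + y) / 2) < (f x + f y) / 2"
    using f[unfolded strictly_convex_def, rule_format, of x y "1/2"] \<open>y \<noteq> x\<close>
    by (simp add: field_simps)
  ultimately show ?thesis by simp
qed

locale dissipation_potential =
  fixes \<psi> \<psi>' :: "real \<Rightarrow> real"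
  assumes strict_convex: "strictly_convex \<psi>"
    and has_deriv: "\<And>r. (\<psi> has_real_derivative \<psi>' r) (at r)"
    and cont_deriv: "continuous_on UNIV \<psi>'"
    and nonneg: "\<And>r. \<psi> r \<ge> 0"
    and zero [simp]: "\<psi> 0 = 0"
begin

lemma above_tangent: "\<psi> r + \<psi>' r * (q - r) \<le> \<psi> q"
  using strictly_convex_above_tangent[OF strict_convex has_deriv, of q r] by (cases "q = r") auto

text \<open>Adding the strict tangent inequalities at \<open>r\<close> and at \<open>q\<close>
  cancels the values of \<open>\<psi>\<close>.\<close>

lemma deriv_strict_mono: "r < q \<Longrightarrow> \<psi>' r < \<psi>' q"
  using strictly_convex_above_tangent[OF strict_convex has_deriv, of q r]
    strictly_convex_above_tangent[OF strict_convex has_deriv, of r q]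
  by (smt (verit) mult_less_cancel_right mult_minus_right right_diff_distrib)

lemma deriv_mono: "r \<le> q \<Longrightarrow> \<psi>' r \<le> \<psi>' q"
  using deriv_strict_mono[of r q] by (cases "r = q") auto

lemma deriv_zero [simp]: "\<psi>' 0 = 0"
proof (rule DERIV_local_min[OF has_deriv, of 1])
  show "\<forall>y. \<bar>0 - y\<bar> < 1 \<longrightarrow> \<psi> 0 \<le> \<psi> y" using nonneg by simp
qed simp

lemma deriv_nonneg: "r \<ge> 0 \<Longrightarrow> \<psi>' r \<ge> 0"
  using deriv_mono[of 0 r] by simp

lemma mono_nonneg: "0 \<le> r \<Longrightarrow> r \<le> q \<Longrightarrow> \<psi> r \<le> \<psi> q"
  using above_tangent[of r q] deriv_nonneg[of r] by (smt (verit) mult_nonneg_nonneg)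

text \<open>For \<open>r \<ge> 0\<close> this is the conjugate of \<open>\<psi>\<close> at
  \<open>\<psi>' r\<close>, the equality case of Fenchel-Young. At \<open>r = d / \<sigma>\<close>
  it is also minus the derivative of \<open>\<sigma> * \<psi> (d / \<sigma>)\<close> in
  \<open>\<sigma>\<close>.\<close>

definition conj_deriv :: "real \<Rightarrow> real" where
  "conj_deriv r = r * \<psi>' r - \<psi> r"

lemma conj_deriv_nonneg: "conj_deriv r \<ge> 0"
  using above_tangent[of r 0] by (simp add: conj_deriv_def algebra_simps)

text \<open>The number \<open>r * \<psi>' q - \<psi> r\<close> lies between the two values, by
  monotonicity of \<open>\<psi>'\<close> and by the tangent at \<open>q\<close>.\<close>

lemma conj_deriv_mono:
  assumes "0 \<le> r" "r \<le> q"
  shows "conj_deriv r \<le> conj_deriv q"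
proof -
  have "r * (\<psi>' q - \<psi>' r) \<ge> 0"
    using assms deriv_mono[of r q] by simp
  then show ?thesis
    using above_tangent[of q r] unfolding conj_deriv_def by (simp add: algebra_simps)
qed

lemma continuous_conj_deriv: "isCont conj_deriv r"
proof -
  have "isCont \<psi> r" using has_deriv by (rule DERIV_isCont)
  moreover have "isCont \<psi>' r"
    using cont_deriv by (simp add: continuous_on_eq_continuous_at)
  ultimately show ?thesis
    unfolding conj_deriv_def by (intro continuous_intros)
qed

text \<open>By the tangent inequality at \<open>r\<close>, the supremum is attained at
  \<open>q = r\<close>.\<close>

lemma convex_conjugate_deriv:
  assumes "r \<ge> 0"
  shows "convex_conjugate \<psi> (ereal (\<psi>' r)) = ereal (conj_deriv r)"
  unfolding convex_conjugate_def
proof (rule antisym)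
  show "(SUP q\<in>{0..}. ereal (\<psi>' r) * ereal q - ereal (\<psi> q)) \<le> ereal (conj_deriv r)"
    by (rule SUP_least) (use above_tangent[of r] in \<open>simp add: conj_deriv_def algebra_simps\<close>)
  show "ereal (conj_deriv r) \<le> (SUP q\<in>{0..}. ereal (\<psi>' r) * ereal q - ereal (\<psi> q))"
    by (rule SUP_upper2[of r]) (use assms in \<open>auto simp: conj_deriv_def mult.commute\<close>)
qed

text \<open>The perspective \<open>\<sigma> * \<psi> (d / \<sigma>)\<close> is convex in
  \<open>\<sigma>\<close>, and the left side is its tangent at \<open>\<rho>\<close>: the tangent of
  \<open>\<psi>\<close> at \<open>d / \<rho>\<close>, scaled by \<open>\<sigma>\<close>.\<close>

lemma perspective_above_tangent:
  assumes "\<rho> > 0" "\<sigma> > 0"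
  shows "\<rho> * \<psi> (d / \<rho>) - (\<sigma> - \<rho>) * conj_deriv (d / \<rho>) \<le> \<sigma> * \<psi> (d / \<sigma>)"
proof -
  have "\<sigma> * (\<psi> (d / \<rho>) + \<psi>' (d / \<rho>) * (d / \<sigma> - d / \<rho>)) \<le> \<sigma> * \<psi> (d / \<sigma>)"
    using assms by (intro mult_left_mono above_tangent) auto
  moreover have "\<sigma> * (\<psi> (d / \<rho>) + \<psi>' (d / \<rho>) * (d / \<sigma> - d / \<rho>)) =
    \<rho> * \<psi> (d / \<rho>) - (\<sigma> - \<rho>) * conj_deriv (d / \<rho>)"
    using assms unfolding conj_deriv_def by (simp add: field_simps)
  ultimately show ?thesis by simp
qed

end

section \<open>Monotonicity, derivative and integral of the value function\<close>

text \<open>The function \<open>e\<close> plays the role of the value function \<open>\<sigma> \<mapsto> min \<Phi>\<^sub>\<sigma>(u\<^sub>0; \<cdot>)\<close> and \<open>d\<close> that of the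
  displacement of a minimizer; \<open>value_le\<close> says that the minimizer for \<open>\<rho>\<close> is a competitor for \<open>\<sigma>\<close>.\<close>

locale incremental_minimization = dissipation_potential +
  fixes s :: real and e d :: "real \<Rightarrow> real"
  assumes value_le: "\<And>\<rho> \<sigma>. \<rho> \<in> {0<..<s} \<Longrightarrow> \<sigma> \<in> {0<..<s} \<Longrightarrow>
      e \<sigma> \<le> e \<rho> - \<rho> * \<psi> (d \<rho> / \<rho>) + \<sigma> * \<psi> (d \<rho> / \<sigma>)"
    and d_nonneg: "\<And>\<sigma>. \<sigma> \<in> {0<..<s} \<Longrightarrow> d \<sigma> \<ge> 0"
begin

text \<open>The perspective tangent is taken at the new parameter \<open>\<sigma>\<close>, hence the
  mixed argument \<open>d \<rho> / \<sigma>\<close>. Exchanging \<open>\<rho>\<close> and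
  \<open>\<sigma>\<close> gives the bound from the other side.\<close>

lemma value_diff_le:
  assumes "\<rho> \<in> {0<..<s}" "\<sigma> \<in> {0<..<s}"
  shows "e \<sigma> - e \<rho> \<le> - ((\<sigma> - \<rho>) * conj_deriv (d \<rho> / \<sigma>))"
  using value_le[OF assms] perspective_above_tangent[of \<sigma> \<rho> "d \<rho>"] assms
  by (simp add: algebra_simps)

text \<open>Adding the competitor inequalities for (\<open>\<rho>\<close>, \<open>\<sigma>\<close>)
  and (\<open>\<sigma>\<close>, \<open>\<rho>\<close>) eliminates \<open>e\<close> and leaves
  \<open>k (d \<sigma>) \<le> k (d \<rho>)\<close>, while \<open>k\<close> is strictly decreasing
  for \<open>\<rho> < \<sigma>\<close>.\<close>

lemma mono_on_displacement: "mono_on {0<..<s} d"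
proof (rule mono_onI, rule ccontr)
  fix \<rho> \<sigma> assume \<rho>: "\<rho> \<in> {0<..<s}" and \<sigma>: "\<sigma> \<in> {0<..<s}" and "\<rho> \<le> \<sigma>" and "\<not> d \<rho> \<le> d \<sigma>"
  then have d: "d \<sigma> < d \<rho>" and "\<rho> < \<sigma>" by (auto simp: order_le_less)
  define k where "k x = \<sigma> * \<psi> (x / \<sigma>) - \<rho> * \<psi> (x / \<rho>)" for x
  \<comment> \<open>The derivative of \<open>k\<close> vanishes at 0, and \<open>d \<sigma>\<close>
    may be 0, so negativity is claimed on the open interval only.\<close>
  have "k (d \<rho>) < k (d \<sigma>)"
  proof (rule DERIV_neg_imp_decreasing_open[OF d])
    fix x assume x: "d \<sigma> < x" "x < d \<rho>"
    have "(k has_real_derivative \<sigma> * (\<psi>' (x / \<sigma>) * (1 / \<sigma>)) - \<rho> * (\<psi>' (x / \<rho>) * (1 / \<rho>))) (at x)"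
      unfolding k_def
      by (intro DERIV_diff DERIV_cmult DERIV_chain2[OF has_deriv] DERIV_cdivide DERIV_ident)
    then have "(k has_real_derivative \<psi>' (x / \<sigma>) - \<psi>' (x / \<rho>)) (at x)"
      using \<rho> \<sigma> by simp
    moreover have "x / \<sigma> < x / \<rho>"
      using \<open>\<rho> < \<sigma>\<close> \<rho> d_nonneg[OF \<sigma>] x by (intro divide_strict_left_mono) auto
    then have "\<psi>' (x / \<sigma>) - \<psi>' (x / \<rho>) < 0"
      using deriv_strict_mono by simp
    ultimately show "\<exists>y. (k has_real_derivative y) (at x) \<and> y < 0" by blast
  next
    have "isCont \<psi> r" for r using has_deriv by (rule DERIV_isCont)
    then have "continuous_on UNIV \<psi>" by (simp add: continuous_at_imp_continuous_on)
    note cont = continuous_on_compose2[OF this _ subset_UNIV]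
    show "continuous_on {d \<sigma>..d \<rho>} k"
      unfolding k_def using \<rho> \<sigma> by (intro continuous_intros cont) auto
  qed
  then show False
    using value_le[OF \<rho> \<sigma>] value_le[OF \<sigma> \<rho>] unfolding k_def by linarith
qed

lemma has_derivative_value:
  assumes \<sigma>: "\<sigma> \<in> {0<..<s}" and "isCont d \<sigma>"
  shows "(e has_real_derivative - conj_deriv (d \<sigma> / \<sigma>)) (at \<sigma>)"
proof -
  let ?L = "- conj_deriv (d \<sigma> / \<sigma>)"
  \<comment> \<open>The difference quotient of \<open>e\<close> between \<open>\<sigma>\<close> and
    \<open>y\<close> is squeezed between \<open>l y\<close> and \<open>r y\<close>. Their order
    depends on the side of \<open>\<sigma>\<close> on which \<open>y\<close> lies, hence
    \<open>min\<close> and \<open>max\<close>.\<close>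
  define l where "l y = - conj_deriv (d y / \<sigma>)" for y
  define r where "r y = - conj_deriv (d \<sigma> / y)" for y
  have "(d \<longlongrightarrow> d \<sigma>) (at \<sigma>)" using \<open>isCont d \<sigma>\<close> by (simp add: isCont_def)
  then have l: "(l \<longlongrightarrow> ?L) (at \<sigma>)"
    unfolding l_def using \<sigma>
    by (intro tendsto_minus isCont_tendsto_compose[OF continuous_conj_deriv] tendsto_divide tendsto_const) auto
  have r: "(r \<longlongrightarrow> ?L) (at \<sigma>)"
    unfolding r_def using \<sigma>
    by (intro tendsto_minus isCont_tendsto_compose[OF continuous_conj_deriv] tendsto_divide tendsto_const tendsto_ident_at) auto
  have "eventually (\<lambda>y. y \<in> {0<..<s} \<and> y \<noteq> \<sigma>) (at \<sigma>)"
    using \<sigma> eventually_at_in_open[of "{0<..<s}" \<sigma>] by simp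
  then have bounds: "eventually (\<lambda>y. min (l y) (r y) \<le> (e y - e \<sigma>) / (y - \<sigma>) \<and>
      (e y - e \<sigma>) / (y - \<sigma>) \<le> max (l y) (r y)) (at \<sigma>)"
  proof eventually_elim
    case (elim y)
    have *: "e y - e \<sigma> \<le> (y - \<sigma>) * r y" "(y - \<sigma>) * l y \<le> e y - e \<sigma>"
      using value_diff_le[OF \<sigma>, of y] value_diff_le[OF _ \<sigma>, of y] elim
      by (auto simp: l_def r_def algebra_simps)
    show ?case
    proof (cases "y > \<sigma>")
      case True
      then have "(e y - e \<sigma>) / (y - \<sigma>) \<le> r y" "l y \<le> (e y - e \<sigma>) / (y - \<sigma>)"
        using * by (simp_all add: pos_divide_le_eq pos_le_divide_eq mult.commute)
      then show ?thesis by linarith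
    next
      case False
      then have "r y \<le> (e y - e \<sigma>) / (y - \<sigma>)" "(e y - e \<sigma>) / (y - \<sigma>) \<le> l y"
        using * elim by (simp_all add: neg_divide_le_eq neg_le_divide_eq mult.commute)
      then show ?thesis by linarith
    qed
  qed
  show ?thesis
    unfolding has_field_derivative_iff
  proof (rule real_tendsto_sandwich)
    show "((\<lambda>y. min (l y) (r y)) \<longlongrightarrow> ?L) (at \<sigma>)" "((\<lambda>y. max (l y) (r y)) \<longlongrightarrow> ?L) (at \<sigma>)"
      using tendsto_min[OF l r] tendsto_max[OF l r] by simp_all
  qed (use bounds in \<open>auto elim: eventually_mono\<close>)
qed

lemma has_integral_value:
  assumes "0 < a" "a \<le> b" "b < s"
  shows "((\<lambda>\<sigma>. conj_deriv (d \<sigma> / \<sigma>)) has_integral e a - e b) {a..b}"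
proof -
  have ab: "x \<in> {0<..<s}" if "x \<in> {a..b}" for x using that assms by auto
  \<comment> \<open>All arguments \<open>d y / x\<close> that occur are at most
    \<open>d b / a\<close>, since \<open>d\<close> is monotone and \<open>a \<le> x\<close>.\<close>
  have "(conj_deriv (d b / a))-lipschitz_on {a..b} e"
  proof (rule lipschitz_onI)
    have *: "\<bar>e y - e x\<bar> \<le> conj_deriv (d b / a) * \<bar>y - x\<bar>" if "x \<le> y" "x \<in> {a..b}" "y \<in> {a..b}" for x y
    proof -
      have "d y \<le> d b" by (rule mono_onD[OF mono_on_displacement]) (use ab that assms in auto)
      then have "conj_deriv (d y / x) \<le> conj_deriv (d b / a)"
        using that assms d_nonneg[of y] ab by (intro conj_deriv_mono frac_le divide_nonneg_nonneg) auto
      then have "(y - x) * conj_deriv (d y / x) \<le> (y - x) * conj_deriv (d b / a)"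
        using that by (intro mult_left_mono) auto
      moreover have "e y \<le> e x"
        using value_diff_le[OF ab ab, of x y] that conj_deriv_nonneg[of "d x / y"]
        by (smt (verit) mult_nonneg_nonneg)
      ultimately show ?thesis
        using value_diff_le[OF ab ab, of y x] that by (simp add: algebra_simps)
    qed
    show "dist (e x) (e y) \<le> conj_deriv (d b / a) * dist x y" if "x \<in> {a..b}" "y \<in> {a..b}" for x y
      using *[of x y] *[of y x] that by (cases "x \<le> y") (auto simp: dist_real_def abs_minus_commute)
  qed (rule conj_deriv_nonneg)
  moreover have "negligible {x \<in> {0<..<s}. \<not> isCont d x}"
    by (intro countable_imp_null_set_lborel[THEN null_sets_completionI, folded negligible_iff_null_sets] mono_on_ctble_discont_open mono_on_displacement) auto
  ultimately have "((\<lambda>\<sigma>. - conj_deriv (d \<sigma> / \<sigma>)) has_integral e b - e a) {a..b}"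
    by (rule Lipschitz_fundamental_theorem_of_calculus[OF \<open>a \<le> b\<close>])
      (use ab in \<open>auto intro!: has_derivative_value\<close>)
  from has_integral_neg[OF this] show ?thesis by simp
qed

text \<open>The integral formula needs a positive left endpoint, so \<open>(0, b)\<close> is
  exhausted by the intervals from \<open>b / (n + 1)\<close> to \<open>b\<close>; the integrand is
  nonnegative and monotone convergence applies.\<close>

lemma nn_integral_value:
  assumes lim: "(e \<longlongrightarrow> e\<^sub>0) (at_right 0)" and b: "b \<in> {0<..<s}"
  shows "(\<integral>\<^sup>+\<sigma>\<in>{0<..<b}. ennreal (conj_deriv (d \<sigma> / \<sigma>)) \<partial>lebesgue) = ennreal (e\<^sub>0 - e b)"
proof -
  define a where "a n = b / real (Suc n)" for n
  have a: "0 < a n" "a n \<le> b" "a (Suc n) \<le> a n" for n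
    using b by (auto simp: a_def field_simps)
  have a0: "a \<longlonglongrightarrow> 0"
    unfolding a_def by (rule LIMSEQ_Suc) (rule lim_const_over_n)
  have "filterlim a (at_right 0) sequentially"
    using a0 a(1) by (auto simp: filterlim_at intro!: always_eventually) (metis less_irrefl)
  then have e_lim: "(\<lambda>n. e (a n) - e b) \<longlonglongrightarrow> e\<^sub>0 - e b"
    by (intro tendsto_diff tendsto_const filterlim_compose[OF lim])
  let ?g = "\<lambda>\<sigma>. conj_deriv (d \<sigma> / \<sigma>)"
  have "(?g has_integral e\<^sub>0 - e b) {0..b}"
  proof (rule has_integral_monotone_convergence_increasing[OF _ _ _ e_lim])
    show "((\<lambda>x. if x \<in> {a n..b} then ?g x else 0) has_integral e (a n) - e b) {0..b}" for n
      using has_integral_value[of "a n" b] a(1,2)[of n] b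
      by (subst has_integral_restrict) auto
    show "(if x \<in> {a n..b} then ?g x else 0) \<le> (if x \<in> {a (Suc n)..b} then ?g x else 0)" for n x
      using a(3)[of n] conj_deriv_nonneg[of "d x / x"] by auto
    show "(\<lambda>n. if x \<in> {a n..b} then ?g x else 0) \<longlonglongrightarrow> ?g x" if x: "x \<in> {0..b}" for x
    \<comment> \<open>Division by zero gives \<open>d 0 / 0 = 0\<close> and
      \<open>conj_deriv 0 = 0\<close>, in agreement with the truncated functions at 0.\<close>
    proof (cases "x = 0")
      case True
      then have "(\<lambda>n. if x \<in> {a n..b} then ?g x else 0) = (\<lambda>_. ?g x)"
        using a(1) by (auto simp: conj_deriv_def)
      then show ?thesis by simp
    next
      case False
      then have "eventually (\<lambda>n. a n < x) sequentially"
        using order_tendstoD(2)[OF a0, of x] x by simp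
      then show ?thesis
        by (intro tendsto_eventually, elim eventually_mono) (use x in auto)
    qed
  qed
  then have "(?g has_integral e\<^sub>0 - e b) {0<..<b}"
    by (simp only: has_integral_Icc_iff_Ioo)
  from nn_integral_has_integral_lebesgue'[OF conj_deriv_nonneg this] show ?thesis
    by (simp add: nn_integral_completion)
qed

end

section \<open>Metric slope and descent along geodesics\<close>

lemma metric_slope_nonneg: "metric_slope F u \<ge> 0"
proof -
  have "0 \<le> Limsup (at u) (\<lambda>v. max 0 (F u - F v) / ereal (dist u v))" if "at u \<noteq> bot"
    using that by (rule le_Limsup) (intro always_eventually, simp)
  then show ?thesis by (simp add: metric_slope_def)
qed

text \<open>The limsup bound holds eventually in the punctured neighbourhood and is multiplied by
  the distance; at \<open>v = u\<close> the inequality is trivial.\<close>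

lemma metric_slope_less_imp_descent:
  assumes slope: "metric_slope F u < ereal c" and fin: "\<bar>F u\<bar> \<noteq> \<infinity>" and pos: "\<And>v. F v > -\<infinity>"
  shows "eventually (\<lambda>v. F u \<le> F v + ereal (c * dist u v)) (nhds u)"
proof -
  have u: "u \<in> edom F" using fin by (auto simp: edom_def)
  have "eventually (\<lambda>v. max 0 (F u - F v) / ereal (dist u v) < ereal c) (at u)"
    using slope u by (cases "at u = bot") (auto simp: metric_slope_def intro: Limsup_lessD)
  moreover have "eventually (\<lambda>v. v \<noteq> u) (at u)"
    by (simp add: eventually_at_filter)
  ultimately have "eventually (\<lambda>v. F u \<le> F v + ereal (c * dist u v)) (at u)"
  proof eventually_elim
    case (elim v)
    have d: "0 < ereal (dist u v)" using elim(2) by simp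
    have "F u - F v \<le> max 0 (F u - F v)" by simp
    also have "\<dots> \<le> ereal (dist u v) * ereal c"
      using less_imp_le[OF elim(1)] d by (subst (asm) ereal_divide_le_pos) auto
    finally show ?case using fin pos[of v]
      by (cases "F u"; cases "F v") (auto simp: mult.commute)
  qed
  then show ?thesis
    using fin by (auto simp: eventually_nhds_conv_at)
qed

text \<open>By compactness there is a last point \<open>T\<close> with \<open>k a \<le> k T\<close>.
  If \<open>T < b\<close>, the local hypothesis would produce a later one.\<close>

lemma locally_increasing_imp_le:
  fixes k :: "real \<Rightarrow> real"
  assumes "a \<le> b" and cont: "continuous_on {a..b} k"
    and incr: "\<And>t. a \<le> t \<Longrightarrow> t < b \<Longrightarrow> eventually (\<lambda>x. k t \<le> k x) (at_right t)"
  shows "k a \<le> k b"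
proof -
  let ?S = "{a..b} \<inter> k -` {k a..}"
  have "closed ?S"
    using cont by (rule continuous_closed_preimage) auto
  then have "compact ?S"
    by (auto simp: compact_eq_bounded_closed intro: bounded_subset[OF bounded_closed_interval])
  moreover have "a \<in> ?S" using \<open>a \<le> b\<close> by simp
  ultimately obtain T where T: "T \<in> ?S" and max: "\<And>t. t \<in> ?S \<Longrightarrow> t \<le> T"
    using compact_attains_sup[of ?S] by blast
  have "T = b"
  proof (rule ccontr)
    assume "T \<noteq> b"
    then have "T < b" using T by simp
    then have "eventually (\<lambda>x. k T \<le> k x \<and> x \<in> {T<..<b}) (at_right T)"
      using incr[of T] T by (intro eventually_conj eventually_at_right_real) auto
    then obtain x where "k T \<le> k x" "x \<in> {T<..<b}"
      using eventually_happens' trivial_limit_at_right_real by blast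
    then show False using max[of x] T by auto
  qed
  then show ?thesis using T by simp
qed

text \<open>Upper semicontinuity keeps the slope below \<open>c\<close> near \<open>u\<close>. There
  \<open>F\<close> cannot drop along the geodesic faster than at rate \<open>c\<close> per unit
  length.\<close>

lemma descent_along_geodesic:
  fixes F :: "'a::metric_space \<Rightarrow> ereal"
  assumes cont: "continuous_on UNIV F" and pos: "\<And>v. F v > -\<infinity>"
    and usc: "upper_semicontinuous (metric_slope F)"
    and fin: "F u < \<infinity>" and slope: "metric_slope F u < ereal c"
    and "\<gamma> 1 = u" and "D > 0"
    and geo: "\<And>s t. s \<in> {0..1} \<Longrightarrow> t \<in> {0..1} \<Longrightarrow> dist (\<gamma> s) (\<gamma> t) = \<bar>t - s\<bar> * D"
  shows "eventually (\<lambda>t. F (\<gamma> t) \<le> F u + ereal (c * ((1 - t) * D))) (at_left 1)"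
proof -
  have "eventually (\<lambda>w. metric_slope F w < ereal c) (at u)"
    using usc slope by (intro Limsup_lessD) (auto simp: upper_semicontinuous_def intro: le_less_trans)
  then have "eventually (\<lambda>w. metric_slope F w < ereal c) (nhds u)"
    using slope by (simp add: eventually_nhds_conv_at)
  moreover have "eventually (\<lambda>w. F w < \<infinity>) (nhds u)"
    using cont fin by (intro order_tendstoD(2)[of F "F u"])
      (auto simp: continuous_on_def tendsto_nhds_iff)
  ultimately have "eventually (\<lambda>w. metric_slope F w < ereal c \<and> F w < \<infinity>) (nhds u)"
    by (rule eventually_conj)
  then obtain r where "r > 0" and r: "\<And>w. dist w u < r \<Longrightarrow> metric_slope F w < ereal c \<and> F w < \<infinity>"
    unfolding eventually_nhds_metric by blast
  \<comment> \<open>Since \<open>\<gamma> x\<close> has distance \<open>(1 - x) * D\<close> from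
    \<open>u\<close>, the geodesic stays in the ball of radius \<open>r\<close> from this time
    on.\<close>
  have "eventually (\<lambda>t. t \<in> {max 0 (1 - r / D)<..<1}) (at_left (1::real))"
    using \<open>r > 0\<close> \<open>D > 0\<close> by (intro eventually_at_left_real) auto
  then show ?thesis
  proof eventually_elim
    case (elim t)
    have near: "metric_slope F (\<gamma> x) < ereal c" "\<bar>F (\<gamma> x)\<bar> \<noteq> \<infinity>" if x: "x \<in> {t..1}" for x
    proof -
      have "1 - x < r / D" using x elim by auto
      then have "dist (\<gamma> x) u < r"
        using geo[of x 1] x elim \<open>\<gamma> 1 = u\<close> \<open>D > 0\<close> by (auto simp: field_simps)
      from r[OF this] show "metric_slope F (\<gamma> x) < ereal c" "\<bar>F (\<gamma> x)\<bar> \<noteq> \<infinity>"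
        using pos[of "\<gamma> x"] by auto
    qed
    \<comment> \<open>The linear term compensates the fastest possible drop, so the slope bound
      makes \<open>k\<close> locally increasing to the right.\<close>
    define k where "k x = real_of_ereal (F (\<gamma> x)) + c * D * x" for x
    have F_eq: "F (\<gamma> x) = ereal (k x - c * D * x)" if "x \<in> {t..1}" for x
      using near(2)[OF that] by (simp add: k_def ereal_real)
    have gcont: "continuous_on {t..1} \<gamma>"
      using geo elim \<open>D > 0\<close>
      by (intro lipschitz_on_continuous_on[of D]) (auto simp: lipschitz_on_def dist_real_def mult.commute)
    have "k t \<le> k 1"
    proof (rule locally_increasing_imp_le[where k = k and a = t and b = 1])
      have "continuous_on {t..1} (\<lambda>x. F (\<gamma> x))"
        by (rule continuous_on_compose2[OF cont gcont]) simp
      then have "continuous_on {t..1} (\<lambda>x. real_of_ereal (F (\<gamma> x)))"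
        using near(2) continuous_on_iff_real[of "{t..1}" "\<lambda>x. F (\<gamma> x)"] by (simp add: o_def)
      then show "continuous_on {t..1} k"
        unfolding k_def by (intro continuous_intros)
      fix x assume x: "t \<le> x" "x < 1"
      have "(\<gamma> \<longlongrightarrow> \<gamma> x) (at x within {t..1})"
        using gcont x by (auto simp: continuous_on_def)
      then have "(\<gamma> \<longlongrightarrow> \<gamma> x) (at x within {x..1})"
        by (rule tendsto_within_subset) (use x in auto)
      then have "(\<gamma> \<longlongrightarrow> \<gamma> x) (at_right x)"
        using x by (simp add: at_within_Icc_at_right)
      moreover have "eventually (\<lambda>v. F (\<gamma> x) \<le> F v + ereal (c * dist (\<gamma> x) v)) (nhds (\<gamma> x))"
        using near[of x] x pos by (intro metric_slope_less_imp_descent) auto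
      ultimately have "eventually (\<lambda>y. F (\<gamma> x) \<le> F (\<gamma> y) + ereal (c * dist (\<gamma> x) (\<gamma> y))) (at_right x)"
        by (rule eventually_compose_filterlim[rotated])
      moreover have "eventually (\<lambda>y. y \<in> {x<..<1}) (at_right x)"
        using x by (intro eventually_at_right_real) auto
      ultimately show "eventually (\<lambda>y. k x \<le> k y) (at_right x)"
      proof eventually_elim
        case (elim y)
        moreover have "dist (\<gamma> x) (\<gamma> y) = (y - x) * D"
          using geo[of x y] elim(2) x \<open>t \<in> _\<close> by auto
        ultimately show ?case
          using F_eq[of x] F_eq[of y] x by (auto simp: algebra_simps)
      qed
    qed (use elim in auto)
    then show ?case
      using F_eq[of t] F_eq[of 1] elim \<open>\<gamma> 1 = u\<close> by (auto simp: algebra_simps)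
  qed
qed

section \<open>The metric slope at a minimizer\<close>

lemma minimizer_le:
  assumes "u \<in> J \<E> \<psi> \<tau> u\<^sub>0"
  shows "ereal (\<tau> * \<psi> (dist u\<^sub>0 u / \<tau>)) + \<E> u \<le> ereal (\<tau> * \<psi> (dist u\<^sub>0 v / \<tau>)) + \<E> v"
  using assms by (auto simp: J_def \<Phi>_def)

context dissipation_potential
begin

text \<open>Minimality bounds \<open>\<E> u - \<E> v\<close> by the growth of the dissipation term.
  The triangle inequality and the tangent at the far point \<open>?r v\<close> bound this by
  \<open>\<psi>' (?r v) * dist u v\<close>, and \<open>\<psi>'\<close> is continuous.\<close>

lemma metric_slope_minimizer_le:
  assumes u: "u \<in> J \<E> \<psi> \<tau> u\<^sub>0" and "\<tau> > 0" and fin: "\<bar>\<E> u\<bar> \<noteq> \<infinity>" and pos: "\<And>v. \<E> v > -\<infinity>"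
  shows "metric_slope \<E> u \<le> ereal (\<psi>' (dist u\<^sub>0 u / \<tau>))"
proof (cases "at u = bot")
  case True
  then show ?thesis using fin \<open>\<tau> > 0\<close> by (auto simp: metric_slope_def edom_def deriv_nonneg)
next
  case False
  let ?r = "\<lambda>v. (dist u\<^sub>0 u + dist u v) / \<tau>"
  have bound: "max 0 (\<E> u - \<E> v) / ereal (dist u v) \<le> ereal (\<psi>' (?r v))" if "v \<noteq> u" for v
  proof -
    have "\<psi> (dist u\<^sub>0 v / \<tau>) \<le> \<psi> (?r v)"
      using \<open>\<tau> > 0\<close> by (intro mono_nonneg divide_right_mono dist_triangle) auto
    moreover have "\<psi> (?r v) + \<psi>' (?r v) * (dist u\<^sub>0 u / \<tau> - ?r v) \<le> \<psi> (dist u\<^sub>0 u / \<tau>)"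
      by (rule above_tangent)
    ultimately have "\<psi> (dist u\<^sub>0 v / \<tau>) - \<psi> (dist u\<^sub>0 u / \<tau>) \<le> \<psi>' (?r v) * (?r v - dist u\<^sub>0 u / \<tau>)"
      by (simp add: algebra_simps)
    also have "?r v - dist u\<^sub>0 u / \<tau> = dist u v / \<tau>" by (simp add: add_divide_distrib)
    finally have "\<tau> * (\<psi> (dist u\<^sub>0 v / \<tau>) - \<psi> (dist u\<^sub>0 u / \<tau>)) \<le> \<psi>' (?r v) * dist u v"
      using \<open>\<tau> > 0\<close> by (simp add: pos_le_divide_eq mult.commute)
    then have "\<E> u - \<E> v \<le> ereal (dist u v) * ereal (\<psi>' (?r v))"
      using minimizer_le[OF u, of v] fin pos[of v]
      by (cases "\<E> u"; cases "\<E> v") (auto simp: algebra_simps)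
    moreover have "0 \<le> ereal (dist u v) * ereal (\<psi>' (?r v))"
      using \<open>\<tau> > 0\<close> by (simp add: deriv_nonneg)
    ultimately show ?thesis
      using \<open>v \<noteq> u\<close> by (subst ereal_divide_le_pos) auto
  qed
  have "isCont \<psi>' (dist u\<^sub>0 u / \<tau>)"
    using cont_deriv by (simp add: continuous_on_eq_continuous_at)
  moreover have "(?r \<longlongrightarrow> (dist u\<^sub>0 u + dist u u) / \<tau>) (at u)"
    using \<open>\<tau> > 0\<close> by (intro tendsto_intros) auto
  ultimately have "((\<lambda>v. \<psi>' (?r v)) \<longlongrightarrow> \<psi>' (dist u\<^sub>0 u / \<tau>)) (at u)"
    by (auto intro: isCont_tendsto_compose)
  then have "Limsup (at u) (\<lambda>v. ereal (\<psi>' (?r v))) = ereal (\<psi>' (dist u\<^sub>0 u / \<tau>))"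
    using False by (intro lim_imp_Limsup) auto
  moreover have "Limsup (at u) (\<lambda>v. max 0 (\<E> u - \<E> v) / ereal (dist u v)) \<le> Limsup (at u) (\<lambda>v. ereal (\<psi>' (?r v)))"
    by (rule Limsup_mono) (auto simp: eventually_at_filter bound)
  ultimately show ?thesis
    using False fin by (auto simp: metric_slope_def edom_def)
qed

text \<open>Along the geodesic from \<open>u\<^sub>0\<close> to the minimizer the energy decreases near \<open>u\<close> at rate at least
  \<open>\<psi>'(d/\<tau>)\<close>, so there are points arbitrarily close to \<open>u\<close> where the slope is almost that large;
  upper semicontinuity transfers the bound to \<open>u\<close>.\<close>

lemma metric_slope_minimizer_ge:
  fixes \<E> :: "'a::metric_space \<Rightarrow> ereal"
  assumes u: "u \<in> J \<E> \<psi> \<tau> u\<^sub>0" and "\<tau> > 0" and fin: "\<bar>\<E> u\<bar> \<noteq> \<infinity>" and pos: "\<And>v. \<E> v > -\<infinity>"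
    and "geodesic_space (UNIV :: 'a set)" and cont: "continuous_on UNIV \<E>"
    and usc: "upper_semicontinuous (metric_slope \<E>)"
  shows "ereal (\<psi>' (dist u\<^sub>0 u / \<tau>)) \<le> metric_slope \<E> u"
proof (rule ccontr)
  define d where "d = dist u\<^sub>0 u"
  assume "\<not> ?thesis"
  then obtain c where slope: "metric_slope \<E> u < ereal c" and c: "c < \<psi>' (d / \<tau>)"
    unfolding d_def not_le by (meson ereal_dense2 less_ereal.simps(1))
  \<comment> \<open>A positive \<open>c\<close> below \<open>\<psi>' (d / \<tau>)\<close> excludes
    \<open>d = 0\<close>, so the geodesic is not degenerate.\<close>
  have "c > 0"
    using metric_slope_nonneg[of \<E> u] slope by (metis le_less_trans ereal_less(2))
  then have "d > 0"
    using c by (cases "d = 0") (auto simp: d_def)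
  obtain \<gamma> where \<gamma>: "\<gamma> 0 = u\<^sub>0" "\<gamma> 1 = u"
      "\<And>s t. s \<in> {0..1} \<Longrightarrow> t \<in> {0..1} \<Longrightarrow> dist (\<gamma> s) (\<gamma> t) = \<bar>t - s\<bar> * d"
    using \<open>geodesic_space UNIV\<close> unfolding geodesic_space_def d_def by (metis UNIV_I)
  have "eventually (\<lambda>t. \<E> (\<gamma> t) \<le> \<E> u + ereal (c * ((1 - t) * d))) (at_left 1)"
    using fin by (intro descent_along_geodesic[OF cont pos usc _ slope \<gamma>(2) \<open>d > 0\<close> \<gamma>(3)]) auto
  moreover have "eventually (\<lambda>t. c < \<psi>' (t * d / \<tau>)) (at_left 1)"
  proof (rule order_tendstoD(1)[OF _ c])
    have "isCont \<psi>' (1 * d / \<tau>)"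
      using cont_deriv by (simp add: continuous_on_eq_continuous_at)
    then have "((\<lambda>t. \<psi>' (t * d / \<tau>)) \<longlongrightarrow> \<psi>' (1 * d / \<tau>)) (at_left 1)"
      by (rule isCont_tendsto_compose) (use \<open>\<tau> > 0\<close> in \<open>intro tendsto_intros; simp\<close>)
    then show "((\<lambda>t. \<psi>' (t * d / \<tau>)) \<longlongrightarrow> \<psi>' (d / \<tau>)) (at_left 1)" by simp
  qed
  moreover have "eventually (\<lambda>t. t \<in> {0<..<1}) (at_left (1::real))"
    by (rule eventually_at_left_real) simp
  ultimately have "eventually (\<lambda>t. False) (at_left (1::real))"
  proof eventually_elim
    case (elim t)
    have "dist u\<^sub>0 (\<gamma> t) = t * d"
      using \<gamma>(3)[of 0 t] \<gamma>(1) elim(3) by simp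
    then have "\<tau> * \<psi> (d / \<tau>) \<le> \<tau> * \<psi> (t * d / \<tau>) + c * ((1 - t) * d)"
      using minimizer_le[OF u, of "\<gamma> t"] elim(1) fin pos[of "\<gamma> t"]
      by (cases "\<E> u"; cases "\<E> (\<gamma> t)") (auto simp: d_def)
    \<comment> \<open>Minimality against \<open>\<gamma> t\<close> allows the dissipation to grow by
      at most \<open>c * ((1 - t) * d\<close>) from \<open>\<gamma> t\<close> to \<open>u\<close>;
      the tangent at \<open>t * d / \<tau>\<close> forces a larger growth.\<close>
    moreover have "\<tau> * (\<psi> (t * d / \<tau>) + \<psi>' (t * d / \<tau>) * (d / \<tau> - t * d / \<tau>)) \<le> \<tau> * \<psi> (d / \<tau>)"
      using \<open>\<tau> > 0\<close> by (intro mult_left_mono above_tangent) simp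
    moreover have "\<tau> * (d / \<tau> - t * d / \<tau>) = (1 - t) * d"
      using \<open>\<tau> > 0\<close> by (simp add: field_simps)
    then have "\<tau> * (\<psi>' (t * d / \<tau>) * (d / \<tau> - t * d / \<tau>)) = \<psi>' (t * d / \<tau>) * ((1 - t) * d)"
      by (metis mult.left_commute)
    ultimately have "\<psi>' (t * d / \<tau>) * ((1 - t) * d) \<le> c * ((1 - t) * d)"
      by (simp add: distrib_left)
    moreover have "(1 - t) * d > 0"
      using \<open>d > 0\<close> elim(3) by simp
    ultimately show False using elim(2) by (metis mult_le_cancel_right_pos not_le)
  qed
  then show False by simp
qed

end

section \<open>Convergence of the minimizers to the initial point and the energy identity\<close>

theorem theorem2p15:
  fixes \<E> :: "'a::complete_space \<Rightarrow> ereal"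
    and \<psi> :: "real \<Rightarrow> real"
    and E\<^sub>0 \<sigma>\<^sub>s \<sigma> :: real
    and u\<^sub>0 :: 'a
    and u :: "real \<Rightarrow> 'a"
  assumes "generalized_metric_gradient_system \<E> \<psi>"
    and "\<psi> C1_differentiable_on UNIV"
    and "strictly_convex \<psi>"
    and "(INF v. \<E> v) > ereal E\<^sub>0" and "E\<^sub>0 > 0"
    and "\<sigma>\<^sub>s > 0"
    and "\<And>\<tau> v. \<tau> \<in> {0<..<\<sigma>\<^sub>s} \<Longrightarrow> v \<in> edom \<E> \<Longrightarrow> J \<E> \<psi> \<tau> v \<noteq> {}"
    and "geodesic_space (UNIV :: 'a set)"
    and "continuous_on UNIV \<E>"
    and "upper_semicontinuous (metric_slope \<E>)"
    and "u\<^sub>0 \<in> edom \<E>"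
    and "u \<in> lebesgue_on {0<..<\<sigma>\<^sub>s} \<rightarrow>\<^sub>M borel"
    and "\<And>\<tau>. \<tau> \<in> {0<..<\<sigma>\<^sub>s} \<Longrightarrow> u \<tau> \<in> J \<E> \<psi> \<tau> u\<^sub>0"
    and "\<sigma> \<in> {0<..<\<sigma>\<^sub>s}"
  shows "\<E> (u \<sigma>) + ereal (\<sigma> * \<psi> (1 / \<sigma> * dist u\<^sub>0 (u \<sigma>)))
      + enn2ereal (\<integral>\<^sup>+\<rho>\<in>{0<..<\<sigma>}. e2ennreal (convex_conjugate \<psi> (metric_slope \<E> (u \<rho>))) \<partial>lebesgue)
    = \<E> u\<^sub>0"
proof -
  interpret generalized_metric_gradient_system \<E> \<psi> by fact
  obtain \<psi>' where \<psi>': "\<And>r. (\<psi> has_real_derivative \<psi>' r) (at r)" "continuous_on UNIV \<psi>'"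
    using \<open>\<psi> C1_differentiable_on UNIV\<close>
    by (auto simp: C1_differentiable_on_def has_real_derivative_iff_has_vector_derivative)
  interpret dissipation_potential \<psi> \<psi>'
    by unfold_locales (use \<psi>' psi_nonneg psi_zero \<open>strictly_convex \<psi>\<close> in auto)
  note min = assms(13)
  define d where "d \<tau> = dist u\<^sub>0 (u \<tau>)" for \<tau>
  define E where "E v = real_of_ereal (\<E> v)" for v
  have lower: "ereal E\<^sub>0 \<le> \<E> v" for v
    using \<open>ereal E\<^sub>0 < (INF v. \<E> v)\<close> by (meson INF_lower UNIV_I less_imp_le order.trans)
  have E_eq: "\<E> v = ereal (E v)" if "\<E> v < \<infinity>" for v
    using that energy_not_minfty[of v] by (auto simp: E_def ereal_real)
  have E\<^sub>0: "\<E> u\<^sub>0 = ereal (E u\<^sub>0)"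
    using \<open>u\<^sub>0 \<in> edom \<E>\<close> by (intro E_eq) (simp add: edom_def)
  \<comment> \<open>Comparison with \<open>u\<^sub>0\<close>, whose energy is finite and whose
    dissipation term is zero.\<close>
  have Eu: "\<E> (u \<tau>) = ereal (E (u \<tau>))" if "\<tau> \<in> {0<..<\<sigma>\<^sub>s}" for \<tau>
    using minimizer_le[OF min[OF that], of u\<^sub>0] E\<^sub>0 by (intro E_eq) auto
  define e where "e \<tau> = \<tau> * \<psi> (d \<tau> / \<tau>) + E (u \<tau>)" for \<tau>
  interpret incremental_minimization \<psi> \<psi>' \<sigma>\<^sub>s e d
  proof unfold_locales
    fix \<rho> \<tau> assume "\<rho> \<in> {0<..<\<sigma>\<^sub>s}" "\<tau> \<in> {0<..<\<sigma>\<^sub>s}"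
    then show "e \<tau> \<le> e \<rho> - \<rho> * \<psi> (d \<rho> / \<rho>) + \<tau> * \<psi> (d \<rho> / \<tau>)"
      using minimizer_le[OF min, of \<tau> "u \<rho>"] by (simp add: Eu e_def d_def)
  qed (simp add: d_def)
  have e_le: "e \<tau> \<le> E u\<^sub>0" if "\<tau> \<in> {0<..<\<sigma>\<^sub>s}" for \<tau>
    using minimizer_le[OF min[OF that], of u\<^sub>0] Eu[OF that] E\<^sub>0 by (simp add: e_def d_def)
  have small: "eventually (\<lambda>\<tau>. \<tau> \<in> {0<..<\<sigma>\<^sub>s}) (at_right 0)"
    using \<open>\<sigma>\<^sub>s > 0\<close> by (rule eventually_at_right_real)
  have "(u \<longlongrightarrow> u\<^sub>0) (at_right 0)"
  proof (rule tendstoI)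
    fix \<delta> :: real assume "\<delta> > 0"
    \<comment> \<open>With this choice \<open>K * \<delta>\<close> exceeds the largest available
      energy drop \<open>E u\<^sub>0 - E\<^sub>0\<close> by 1. A displacement of at least
      \<open>\<delta>\<close> would cost more than \<open>K * \<delta>\<close> once
      \<open>d \<tau> / \<tau> \<ge> R\<close>, which \<open>\<tau> < \<delta> / R\<close>
      ensures.\<close>
    define K where "K = (E u\<^sub>0 - E\<^sub>0 + 1) / \<delta>"
    have "eventually (\<lambda>r. K < \<psi> r / r) at_top"
      using psi_superlinear by (simp add: filterlim_at_top_dense)
    then have "eventually (\<lambda>R. R > 0 \<and> (\<forall>r\<ge>R. K < \<psi> r / r)) at_top"
      by (intro eventually_conj eventually_gt_at_top eventually_all_ge_at_top)
    then obtain R where "R > 0" and R: "\<And>r. r \<ge> R \<Longrightarrow> K < \<psi> r / r"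
      using eventually_happens by force
    have "K > 0"
      using lower[of u\<^sub>0] \<open>\<delta> > 0\<close> by (simp add: K_def E\<^sub>0)
    have "eventually (\<lambda>\<tau>. \<tau> \<in> {0<..<\<delta> / R}) (at_right 0)"
      using \<open>\<delta> > 0\<close> \<open>R > 0\<close> by (intro eventually_at_right_real) simp
    with small show "eventually (\<lambda>\<tau>. dist (u \<tau>) u\<^sub>0 < \<delta>) (at_right 0)"
    proof eventually_elim
      case (elim \<tau>)
      show ?case
      proof (rule ccontr)
        assume "\<not> dist (u \<tau>) u\<^sub>0 < \<delta>"
        then have d: "\<delta> \<le> d \<tau>" by (simp add: d_def dist_commute)
        have "R \<le> \<delta> / \<tau>" using elim(2) \<open>R > 0\<close> by (simp add: field_simps)
        also have "\<dots> \<le> d \<tau> / \<tau>" using d elim by (intro divide_right_mono) auto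
        finally have "K < \<psi> (d \<tau> / \<tau>) / (d \<tau> / \<tau>)" by (rule R)
        then have "K * d \<tau> < \<tau> * \<psi> (d \<tau> / \<tau>)"
          using d \<open>\<delta> > 0\<close> elim(2) by (simp add: field_simps)
        moreover have "K * \<delta> \<le> K * d \<tau>"
          using d \<open>K > 0\<close> by simp
        moreover have "K * \<delta> = E u\<^sub>0 - E\<^sub>0 + 1"
          using \<open>\<delta> > 0\<close> by (simp add: K_def)
        moreover have "\<tau> * \<psi> (d \<tau> / \<tau>) \<le> E u\<^sub>0 - E\<^sub>0"
          using e_le[OF elim(1)] lower[of "u \<tau>"] Eu[OF elim(1)] by (simp add: e_def)
        ultimately show False by linarith
      qed
    qed
  qed
  moreover have "isCont \<E> u\<^sub>0"
    using \<open>continuous_on UNIV \<E>\<close> by (simp add: continuous_on_eq_continuous_at)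
  ultimately have "((\<lambda>\<tau>. \<E> (u \<tau>)) \<longlongrightarrow> ereal (E u\<^sub>0)) (at_right 0)"
    unfolding E\<^sub>0[symmetric] by (rule isCont_tendsto_compose[rotated])
  then have "((\<lambda>\<tau>. E (u \<tau>)) \<longlongrightarrow> E u\<^sub>0) (at_right 0)"
    unfolding E_def[abs_def] by (rule lim_real_of_ereal)
  \<comment> \<open>The squeeze \<open>E (u \<tau>) \<le> e \<tau> \<le> E u\<^sub>0\<close> avoids
    a separate limit of the dissipation term.\<close>
  then have lim: "(e \<longlongrightarrow> E u\<^sub>0) (at_right 0)"
  proof (rule real_tendsto_sandwich[rotated 2])
    show "eventually (\<lambda>\<tau>. E (u \<tau>) \<le> e \<tau>) (at_right 0)"
      using small by eventually_elim (simp add: e_def nonneg)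
    show "eventually (\<lambda>\<tau>. e \<tau> \<le> E u\<^sub>0) (at_right 0)"
      using small by eventually_elim (rule e_le)
  qed simp
  have slope: "metric_slope \<E> (u \<rho>) = ereal (\<psi>' (d \<rho> / \<rho>))" if \<rho>: "\<rho> \<in> {0<..<\<sigma>\<^sub>s}" for \<rho>
    unfolding d_def using \<rho> Eu[OF \<rho>] energy_not_minfty assms(8-10)
    by (intro antisym metric_slope_minimizer_le metric_slope_minimizer_ge min) auto
  have "(\<integral>\<^sup>+\<rho>\<in>{0<..<\<sigma>}. e2ennreal (convex_conjugate \<psi> (metric_slope \<E> (u \<rho>))) \<partial>lebesgue) =
      (\<integral>\<^sup>+\<rho>\<in>{0<..<\<sigma>}. ennreal (conj_deriv (d \<rho> / \<rho>)) \<partial>lebesgue)"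
    using \<open>\<sigma> \<in> {0<..<\<sigma>\<^sub>s}\<close>
    by (intro nn_integral_cong) (auto simp: indicator_def slope convex_conjugate_deriv d_nonneg)
  also have "\<dots> = ennreal (E u\<^sub>0 - e \<sigma>)"
    using lim \<open>\<sigma> \<in> {0<..<\<sigma>\<^sub>s}\<close> by (rule nn_integral_value)
  \<comment> \<open>By \<open>e_le\<close> the difference \<open>E u\<^sub>0 - e \<sigma>\<close> is
    nonnegative, so \<open>ennreal\<close> does not truncate it.\<close>
  finally show ?thesis
    using Eu[OF \<open>\<sigma> \<in> {0<..<\<sigma>\<^sub>s}\<close>] e_le[OF \<open>\<sigma> \<in> {0<..<\<sigma>\<^sub>s}\<close>] E\<^sub>0
    by (simp add: e_def d_def)
qed

end
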